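(* Let $X\sim p$ and $Y\sim q$ be random vectors in $\mathbb{R}^d$; assume that the densities $p$ and $q$ both satisfy Assumption A. Assume moreover that $\Omega_p=\Omega_q$, and that this set is connected. Let $f:\mathbb{R}^d\to\mathbb{R}$ belong to $\mathcal{F}_1(p)$, and assume $f>0$ on $\Omega_p$. 1. $Y$ has the same law as $X$ if and only if, for all $\mathbf{g}:\mathbb{R}^d\to\mathbb{R}^d$ in $\mathrm{dom}(p,f)$, $$\mathbb{E}_q\left[(\mathcal{T}_{\mathrm{div},p}\,\mathbf{g})\,f\right]=-\mathbb{E}_q\left[\langle\mathbf{g},\nabla f\rangle\right].$$ 2. $Y$ has the same law as $X$ if and only if, for all $g:\mathbb{R}^d\to\mathbb{R}$ in $\mathrm{dom}(p,f)$, $$\mathbb{E}_q\left[(\mathcal{T}_{\nabla,p}\,g)\,f\right]=-\mathbb{E}_q\left[g\,(\nabla f)\right].$$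
   Context: Assumption A (for a density $p$): $K_p$ denotes the support of $p$ (the complement of the largest open set on which $p\equiv 0$); there exists an open set $\Omega_p$ such that the Lebesgue measure of $K_p\setminus\Omega_p$ is zero, $p>0$ on $\Omega_p$, and $p$ is $\mathcal{C}^1$ on $\Omega_p$. $\mathbb{E}_q[u]=\int_{K_q}u(x)q(x)\,dx$ (componentwise for vector valued $u$). $S^{d-1}$ is the unit sphere of $\mathbb{R}^d$, $\partial_e$ the directional derivative in direction $e$, $e_1,\dots,e_d$ the canonical basis. $\mathcal{F}_1(p)$ is the set of functions $\varphi:\mathbb{R}^d\to\mathbb{R}$ such that the restriction of $\varphi$ to $\Omega_p$ is $\mathcal{C}^1$, $p\varphi$ has integrable gradient, and $\int_{\mathbb{R}^d}\partial_{e_i}(p\varphi)=0$ for $i=1,\dots,d$. $\mathcal{F}(p)$ is the set of scalar, vector and matrix valued functions all of whose components lie in $\mathcal{F}_1(p)$. $\mathcal{T}_{\nabla,p}g=\nabla(pg)/p$ for scalar $g$ and $\mathcal{T}_{\mathrm{div},p}\mathbf{g}=\mathrm{div}(p\mathbf{g})/p$ for vector valued $\mathbf{g}$. For $f\in\mathcal{F}_1(p)$, a scalar or vector valued function $\mathbf{g}$ belongs to $\mathrm{dom}(p,f)$ if $\mathbf{g}$ is $\mathcal{C}^1$ on $\Omega_p$, $f\mathbf{g}\in\mathcal{F}(p)$, and $f\,\partial_e\mathbf{g}\in L^1(p)$ for all $e\in S^{d-1}$. *)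

theory Defs
  imports "HOL-Probability.Probability"
begin

text \<open>
  Functions such as \<open>f\<close> and \<open>g\<close> below are unconstrained off \<open>\<Omega>\<close>, so integrands may behave
  arbitrarily on the null set \<open>K\<^sub>p - \<Omega>\<close>; all integrals are therefore taken with respect to the
  complete measure \<^const>\<open>lebesgue\<close>.
\<close>

definition supp :: "('a::topological_space \<Rightarrow> real) \<Rightarrow> 'a set" where
  "supp p = - \<Union>{U. open U \<and> (\<forall>x\<in>U. p x = 0)}"

definition C1_on :: "('a::real_normed_vector \<Rightarrow> 'b::real_normed_vector) \<Rightarrow> 'a set \<Rightarrow> bool" where
  "C1_on f S \<longleftrightarrow> (\<exists>f' :: 'a \<Rightarrow> 'a \<Rightarrow>\<^sub>L 'b.
     (\<forall>x\<in>S. (f has_derivative blinfun_apply (f' x)) (at x)) \<and> continuous_on S f')"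

definition dir_deriv :: "'a::real_normed_vector \<Rightarrow> ('a \<Rightarrow> 'b::real_normed_vector) \<Rightarrow> 'a \<Rightarrow> 'b" where
  "dir_deriv e u x = vector_derivative (\<lambda>t. u (x + t *\<^sub>R e)) (at 0)"

definition grad :: "(real ^ 'n \<Rightarrow> real) \<Rightarrow> real ^ 'n \<Rightarrow> real ^ 'n" where
  "grad u x = (\<chi> i. dir_deriv (axis i 1) u x)"

definition divergence :: "(real ^ 'n \<Rightarrow> real ^ 'n) \<Rightarrow> real ^ 'n \<Rightarrow> real" where
  "divergence u x = (\<Sum>i\<in>UNIV. dir_deriv (axis i 1) (\<lambda>y. u y $ i) x)"

text \<open>
  The open set \<open>\<Omega>\<close> is not determined by \<open>p\<close>, so it is carried along as a parameter here and in
  the function classes below.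
\<close>

definition assumption_A :: "(real ^ 'n \<Rightarrow> real) \<Rightarrow> (real ^ 'n) set \<Rightarrow> bool" where
  "assumption_A p \<Omega> \<longleftrightarrow>
     open \<Omega> \<and> supp p - \<Omega> \<in> null_sets lebesgue \<and> (\<forall>x\<in>\<Omega>. 0 < p x) \<and> C1_on p \<Omega>"

text \<open>
  Components are coordinates with respect to \<^const>\<open>Basis\<close>; this covers scalars, vectors and matrices.
  The integral is defined component by component, so a non-integrable component
  (which gets the value \<open>0\<close>) does not affect the others.
\<close>

definition expect :: "(real ^ 'n \<Rightarrow> real) \<Rightarrow> (real ^ 'n \<Rightarrow> 'b::euclidean_space) \<Rightarrow> 'b" where
  "expect q u = (\<Sum>b\<in>Basis. (LINT x:supp q|lebesgue. (u x \<bullet> b) * q x) *\<^sub>R b)"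

definition L1 :: "(real ^ 'n \<Rightarrow> real) \<Rightarrow> (real ^ 'n \<Rightarrow> 'b::euclidean_space) set" where
  "L1 p = {u. set_integrable lebesgue (supp p) (\<lambda>x. p x *\<^sub>R u x)}"

definition stein_class1 :: "(real ^ 'n \<Rightarrow> real) \<Rightarrow> (real ^ 'n) set \<Rightarrow> (real ^ 'n \<Rightarrow> real) set" where
  "stein_class1 p \<Omega> = {\<phi>. C1_on \<phi> \<Omega> \<and>
     integrable lebesgue (grad (\<lambda>x. p x * \<phi> x)) \<and>
     (\<forall>i. (LINT x|lebesgue. dir_deriv (axis i 1) (\<lambda>y. p y * \<phi> y) x) = 0)}"

definition stein_class ::
  "(real ^ 'n \<Rightarrow> real) \<Rightarrow> (real ^ 'n) set \<Rightarrow> (real ^ 'n \<Rightarrow> 'b::euclidean_space) set" where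
  "stein_class p \<Omega> = {g. \<forall>b\<in>Basis. (\<lambda>x. g x \<bullet> b) \<in> stein_class1 p \<Omega>}"

definition T_grad :: "(real ^ 'n \<Rightarrow> real) \<Rightarrow> (real ^ 'n \<Rightarrow> real) \<Rightarrow> real ^ 'n \<Rightarrow> real ^ 'n" where
  "T_grad p g x = grad (\<lambda>y. p y * g y) x /\<^sub>R p x"

definition T_div :: "(real ^ 'n \<Rightarrow> real) \<Rightarrow> (real ^ 'n \<Rightarrow> real ^ 'n) \<Rightarrow> real ^ 'n \<Rightarrow> real" where
  "T_div p g x = divergence (\<lambda>y. p y *\<^sub>R g y) x / p x"

definition stein_dom ::
  "(real ^ 'n \<Rightarrow> real) \<Rightarrow> (real ^ 'n) set \<Rightarrow> (real ^ 'n \<Rightarrow> real) \<Rightarrow> (real ^ 'n \<Rightarrow> 'b::euclidean_space) set"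
  where
  "stein_dom p \<Omega> f = {g. C1_on g \<Omega> \<and> (\<lambda>x. f x *\<^sub>R g x) \<in> stein_class p \<Omega> \<and>
     (\<forall>e. norm e = 1 \<longrightarrow> (\<lambda>x. f x *\<^sub>R dir_deriv e g x) \<in> L1 p)}"

end

theory Submission
  imports Defs
begin

text \<open>
  On \<open>\<Omega>\<close> the product rule turns the sum of the two integrands into \<open>div (p f g)\<close>, whose integral
  is zero because \<open>f g\<close> is in the Stein class; this gives the identities when \<open>q = p\<close>. Conversely,
  put \<open>h = q / p\<close>. For a test function \<open>\<phi>\<close> with compact support in \<open>\<Omega>\<close>, the function
  \<open>g = \<phi> / (p f)\<close> is admissible (in the vector case, multiplied by a basis vector), and the
  identity becomes \<open>\<integral> h \<partial>\<^sub>i\<phi> = 0\<close>. Hence all partial derivatives of \<open>h\<close> vanish, so \<open>h\<close> is constant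
  on the connected set \<open>\<Omega>\<close>, and the constant is 1 because both densities have integral 1.
\<close>

section \<open>Calculus of C1 functions and directional derivatives\<close>

text \<open>In finite dimension an operator-valued map is continuous once its values on a basis are.
  Derivatives can thus be given as plain functions, without handling the operator norm.\<close>

lemma C1_onI:
  fixes f :: "'a::euclidean_space \<Rightarrow> 'b::real_normed_vector"
  assumes deriv: "\<And>x. x \<in> S \<Longrightarrow> (f has_derivative D x) (at x)"
    and cont: "\<And>i. i \<in> Basis \<Longrightarrow> continuous_on S (\<lambda>x. D x i)"
  shows "C1_on f S"
proof -
  have D: "blinfun_apply (Blinfun (D x)) = D x" if "x \<in> S" for x
    using deriv[OF that] by (intro bounded_linear_Blinfun_apply has_derivative_bounded_linear)
  have "continuous_on S (\<lambda>x. Blinfun (D x))"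
  proof (rule continuous_on_blinfun_componentwise)
    fix i :: 'a assume "i \<in> Basis"
    with cont show "continuous_on S (\<lambda>x. blinfun_apply (Blinfun (D x)) i)"
      using continuous_on_cong[OF refl, of S "\<lambda>x. blinfun_apply (Blinfun (D x)) i" "\<lambda>x. D x i"] D
      by simp
  qed
  then show ?thesis
    unfolding C1_on_def using deriv D by (intro exI[of _ "\<lambda>x. Blinfun (D x)"]) simp
qed

lemma C1_onE:
  assumes "C1_on f S"
  obtains D where "\<And>x. x \<in> S \<Longrightarrow> (f has_derivative D x) (at x)"
    and "\<And>e. continuous_on S (\<lambda>x. D x e)"
proof -
  obtain f' where f': "\<forall>x\<in>S. (f has_derivative blinfun_apply (f' x)) (at x)" "continuous_on S f'"
    using assms unfolding C1_on_def by blast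
  show thesis
    by (rule that[of "\<lambda>x. blinfun_apply (f' x)"]) (use f' in \<open>auto intro!: continuous_intros\<close>)
qed

lemma C1_on_imp_differentiable: "C1_on f S \<Longrightarrow> x \<in> S \<Longrightarrow> f differentiable (at x)"
  unfolding C1_on_def differentiable_def by blast

lemma C1_on_imp_continuous_on: "C1_on f S \<Longrightarrow> continuous_on S f"
  by (meson C1_on_imp_differentiable continuous_at_imp_continuous_on differentiable_imp_continuous_within)

lemma C1_on_bilinear:
  fixes f :: "'a::euclidean_space \<Rightarrow> 'b::real_normed_vector"
  assumes bil: "bounded_bilinear bop" and f: "C1_on f S" and g: "C1_on g S"
  shows "C1_on (\<lambda>x. bop (f x) (g x)) S"
proof -
  obtain F where F: "\<And>x. x \<in> S \<Longrightarrow> (f has_derivative F x) (at x)" "\<And>e. continuous_on S (\<lambda>x. F x e)"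
    using C1_onE[OF f] by blast
  obtain G where G: "\<And>x. x \<in> S \<Longrightarrow> (g has_derivative G x) (at x)" "\<And>e. continuous_on S (\<lambda>x. G x e)"
    using C1_onE[OF g] by blast
  show ?thesis
    by (rule C1_onI[where D = "\<lambda>x e. bop (f x) (G x e) + bop (F x e) (g x)"])
       (auto intro!: bounded_bilinear.FDERIV[OF bil] F G continuous_on_add
          bounded_bilinear.continuous_on[OF bil] C1_on_imp_continuous_on[OF f]
          C1_on_imp_continuous_on[OF g])
qed

lemma C1_on_linear:
  fixes f :: "'a::euclidean_space \<Rightarrow> 'b::real_normed_vector"
  assumes lin: "bounded_linear h" and f: "C1_on f S"
  shows "C1_on (\<lambda>x. h (f x)) S"
proof -
  obtain F where F: "\<And>x. x \<in> S \<Longrightarrow> (f has_derivative F x) (at x)" "\<And>e. continuous_on S (\<lambda>x. F x e)"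
    using C1_onE[OF f] by blast
  show ?thesis
    by (rule C1_onI[where D = "\<lambda>x e. h (F x e)"])
       (auto intro!: bounded_linear.has_derivative[OF lin] F bounded_linear.continuous_on[OF lin])
qed

lemmas C1_on_mult = C1_on_bilinear[OF bounded_bilinear_mult]
  and C1_on_scaleR = C1_on_bilinear[OF bounded_bilinear_scaleR]

lemma C1_on_divide:
  fixes f g :: "'a::euclidean_space \<Rightarrow> real"
  assumes f: "C1_on f S" and g: "C1_on g S" and nz: "\<And>x. x \<in> S \<Longrightarrow> g x \<noteq> 0"
  shows "C1_on (\<lambda>x. f x / g x) S"
proof -
  obtain F where F: "\<And>x. x \<in> S \<Longrightarrow> (f has_derivative F x) (at x)" "\<And>e. continuous_on S (\<lambda>x. F x e)"
    using C1_onE[OF f] by blast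
  obtain G where G: "\<And>x. x \<in> S \<Longrightarrow> (g has_derivative G x) (at x)" "\<And>e. continuous_on S (\<lambda>x. G x e)"
    using C1_onE[OF g] by blast
  show ?thesis
    by (rule C1_onI[where D = "\<lambda>x e. (F x e * g x - f x * G x e) / (g x * g x)"])
       (auto intro!: has_derivative_divide' F G continuous_intros C1_on_imp_continuous_on[OF f]
          C1_on_imp_continuous_on[OF g] nz simp: nz)
qed

text \<open>\<open>dir_deriv\<close> is an unspecified value where no derivative exists. A total
  derivative pins it down, by the chain rule along the line through \<open>x\<close> in direction
  \<open>e\<close>.\<close>

lemma has_derivative_imp_dir_deriv:
  assumes "(u has_derivative D) (at x)"
  shows "((\<lambda>t. u (x + t *\<^sub>R e)) has_vector_derivative D e) (at 0)" and "dir_deriv e u x = D e"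
proof -
  have lin: "bounded_linear D"
    by (rule has_derivative_bounded_linear[OF assms])
  have "((\<lambda>t. u (x + t *\<^sub>R e)) has_derivative (\<lambda>t. D (t *\<^sub>R e))) (at 0)"
    using assms by (auto intro!: derivative_eq_intros has_derivative_compose[of "\<lambda>t. x + t *\<^sub>R e" _ 0 UNIV u D])
  then show *: "((\<lambda>t. u (x + t *\<^sub>R e)) has_vector_derivative D e) (at 0)"
    by (simp add: has_vector_derivative_def linear_cmul[OF bounded_linear.linear[OF lin]])
  show "dir_deriv e u x = D e"
    unfolding dir_deriv_def by (rule vector_derivative_at[OF *])
qed

lemma C1_on_continuous_dir_deriv:
  assumes "C1_on u S"
  shows "continuous_on S (dir_deriv e u)"
proof -
  obtain D where D: "\<And>x. x \<in> S \<Longrightarrow> (u has_derivative D x) (at x)" "\<And>e. continuous_on S (\<lambda>x. D x e)"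
    using C1_onE[OF assms] by blast
  show ?thesis
    using continuous_on_cong[OF refl, of S "dir_deriv e u" "\<lambda>x. D x e"]
      has_derivative_imp_dir_deriv(2)[OF D(1)] D(2) by simp
qed

lemma dir_deriv_bilinear:
  assumes bil: "bounded_bilinear bop"
    and u: "u differentiable (at x)" and v: "v differentiable (at x)"
  shows "dir_deriv e (\<lambda>y. bop (u y) (v y)) x = bop (u x) (dir_deriv e v x) + bop (dir_deriv e u x) (v x)"
proof -
  obtain U V where UV: "(u has_derivative U) (at x)" "(v has_derivative V) (at x)"
    using u v unfolding differentiable_def by blast
  show ?thesis
    using has_derivative_imp_dir_deriv(2)[OF bounded_bilinear.FDERIV[OF bil UV]]
      has_derivative_imp_dir_deriv(2)[OF UV(1)] has_derivative_imp_dir_deriv(2)[OF UV(2)] by simp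
qed

lemmas dir_deriv_mult = dir_deriv_bilinear[OF bounded_bilinear_mult]

lemma dir_deriv_eq_0:
  assumes "open U" "x \<in> U" "\<And>y. y \<in> U \<Longrightarrow> u y = 0"
  shows "dir_deriv e u x = 0"
proof -
  have "(u has_derivative (\<lambda>_. 0)) (at x)"
    by (rule has_derivative_transform_within_open[OF has_derivative_const[of 0] assms(1,2)])
       (use assms in auto)
  then show ?thesis
    using has_derivative_imp_dir_deriv(2) by blast
qed

lemma dir_deriv_eq_0_off_compact:
  fixes u :: "'a::euclidean_space \<Rightarrow> 'b::real_normed_vector"
  assumes "compact K" "\<And>y. y \<notin> K \<Longrightarrow> u y = 0" "x \<notin> K"
  shows "dir_deriv e u x = 0"
  by (rule dir_deriv_eq_0[of "- K"]) (use assms compact_imp_closed in auto)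

text \<open>Off \<open>K\<close> the function vanishes on an open set, so its derivative there is 0.
  By uniqueness this agrees with the given derivative on the part of \<open>\<Omega>\<close> outside
  \<open>K\<close>, so the glued derivative is continuous on the union of two open sets that cover
  the space.\<close>

lemma C1_on_zero_extension:
  fixes u :: "'a::euclidean_space \<Rightarrow> 'b::real_normed_vector"
  assumes "open \<Omega>" "compact K" "K \<subseteq> \<Omega>" "C1_on u \<Omega>" and zero: "\<And>x. x \<notin> K \<Longrightarrow> u x = 0"
  shows "C1_on u UNIV"
proof -
  obtain D where D: "\<And>x. x \<in> \<Omega> \<Longrightarrow> (u has_derivative D x) (at x)" "\<And>e. continuous_on \<Omega> (\<lambda>x. D x e)"
    using C1_onE[OF assms(4)] by blast
  have op: "open (- K)"
    using assms(2) compact_imp_closed by auto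
  have off: "(u has_derivative (\<lambda>_. 0)) (at x)" if "x \<notin> K" for x
    by (rule has_derivative_transform_within_open[OF has_derivative_const[of 0] op]) (use that zero in auto)
  have eq: "D x = (\<lambda>_. 0)" if "x \<in> \<Omega>" "x \<notin> K" for x
    using has_derivative_unique[OF D(1) off] that by blast
  have "continuous_on (\<Omega> \<union> - K) (\<lambda>x. if x \<in> \<Omega> then D x e else 0)" for e
  proof (rule continuous_on_open_Un[OF assms(1) op])
    show "continuous_on \<Omega> (\<lambda>x. if x \<in> \<Omega> then D x e else 0)"
      using continuous_on_cong[OF refl, of \<Omega> "\<lambda>x. if x \<in> \<Omega> then D x e else 0" "\<lambda>x. D x e"] D(2) by simp
    show "continuous_on (- K) (\<lambda>x. if x \<in> \<Omega> then D x e else 0)"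
      using continuous_on_cong[OF refl, of "-K" "\<lambda>x. if x \<in> \<Omega> then D x e else 0" "\<lambda>x. 0"] eq by simp
  qed
  moreover have "\<Omega> \<union> - K = UNIV"
    using assms(3) by blast
  moreover have "(u has_derivative (\<lambda>e. if x \<in> \<Omega> then D x e else 0)) (at x)" for x
    using D(1)[of x] off[of x] assms(3) by (cases "x \<in> \<Omega>") auto
  ultimately show ?thesis
    by (intro C1_onI[where D = "\<lambda>x e. if x \<in> \<Omega> then D x e else 0"]) auto
qed

section \<open>Integrals of compactly supported functions and of their derivatives\<close>

lemma integrable_compact_support:
  fixes u :: "'a::euclidean_space \<Rightarrow> 'b::euclidean_space"
  assumes "continuous_on K u" "compact K" "\<And>x. x \<notin> K \<Longrightarrow> u x = 0"
  shows "integrable lborel u" "integrable lebesgue u"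
proof -
  have "(\<lambda>x. indicator K x *\<^sub>R u x) = u"
    using assms(3) by (auto simp: indicator_def)
  then show 1: "integrable lborel u"
    using borel_integrable_compact[OF assms(2,1)] by simp
  then show "integrable lebesgue u"
    using integrable_completion borel_measurable_integrable by blast
qed

text \<open>
  The difference quotients of \<open>u\<close> have integral zero by translation invariance, and they
  converge dominatedly to the directional derivative.
\<close>

lemma integral_dir_deriv_compact_support:
  fixes u :: "'a::euclidean_space \<Rightarrow> real"
  assumes u: "C1_on u UNIV" and K: "compact K" and zero: "\<And>x. x \<notin> K \<Longrightarrow> u x = 0"
  shows "integrable lebesgue (dir_deriv e u)" "integral\<^sup>L lebesgue (dir_deriv e u) = 0"
proof -
  have cont: "continuous_on S (dir_deriv e u)" for S
    using C1_on_continuous_dir_deriv[OF u] continuous_on_subset by blast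
  have d0: "dir_deriv e u x = 0" if "x \<notin> K" for x
    using dir_deriv_eq_0_off_compact[OF K zero that] .
  note int = integrable_compact_support[OF cont K d0]
  then show "integrable lebesgue (dir_deriv e u)" by blast
  have uint: "integrable lborel u"
    by (rule integrable_compact_support[OF continuous_on_subset[OF C1_on_imp_continuous_on[OF u]] K zero]) auto
  have [measurable]: "u \<in> borel_measurable borel" "dir_deriv e u \<in> borel_measurable borel"
    using uint int(1) borel_measurable_integrable by force+
  obtain B where B0: "\<And>x. x \<in> K \<Longrightarrow> \<bar>dir_deriv e u x\<bar> \<le> B"
    using compact_imp_bounded[OF compact_continuous_image[OF cont K]]
    by (auto simp: bounded_iff)
  \<comment> \<open>The maximum with 0 makes the bound valid off \<open>K\<close> too, even when
    \<open>K\<close> is empty and \<open>B\<close> is arbitrary.\<close>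
  define C where "C = max B 0"
  have C: "\<bar>dir_deriv e u x\<bar> \<le> C" for x
    using B0[of x] d0[of x] by (cases "x \<in> K") (auto simp: C_def)
  obtain R where R: "\<And>x. x \<in> K \<Longrightarrow> norm x \<le> R"
    using compact_imp_bounded[OF K] by (auto simp: bounded_iff)
  obtain D where D: "\<And>x. (u has_derivative D x) (at x)"
    using C1_onE[OF u] by (metis UNIV_I)
  \<comment> \<open>By definition \<open>dir_deriv\<close> only concerns the parameter 0. Moving the
    base point along the line gives the derivative at every parameter, as the mean value theorem
    requires.\<close>
  have der: "((\<lambda>t. u (x + t *\<^sub>R e)) has_real_derivative dir_deriv e u (x + s *\<^sub>R e)) (at s)" for x s
  proof -
    have "((\<lambda>t. u (x + s *\<^sub>R e + t *\<^sub>R e)) has_real_derivative dir_deriv e u (x + s *\<^sub>R e)) (at 0)"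
      using has_derivative_imp_dir_deriv[OF D[of "x + s *\<^sub>R e"]]
      by (simp add: has_real_derivative_iff_has_vector_derivative)
    then show ?thesis
      using DERIV_shift[of "\<lambda>t. u (x + t *\<^sub>R e)" "dir_deriv e u (x + s *\<^sub>R e)" 0 s]
      by (simp add: algebra_simps)
  qed
  \<comment> \<open>Step sizes tending to 0 for dominated convergence; since they are at most 1, the
    supports of all difference quotients stay in one ball.\<close>
  define \<tau> :: "nat \<Rightarrow> real" where "\<tau> n = inverse (real (Suc n))" for n
  have \<tau>: "0 < \<tau> n" "\<tau> n \<le> 1" for n
    by (auto simp: \<tau>_def inverse_le_1_iff)
  define s where "s n x = (u (x + \<tau> n *\<^sub>R e) - u x) / \<tau> n" for n x
  have shift: "integrable lborel (\<lambda>x. u (x + c))" "(\<integral>x. u (x + c) \<partial>lborel) = integral\<^sup>L lborel u" for c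
  proof -
    show "integrable lborel (\<lambda>x. u (x + c))"
      using uint integrable_distr[of "(+) c" lborel borel u] lborel_distr_plus[of c]
      by (simp add: add.commute)
    show "(\<integral>x. u (x + c) \<partial>lborel) = integral\<^sup>L lborel u"
      using integral_distr[of "(+) c" lborel borel u] lborel_distr_plus[of c]
      by (simp add: add.commute)
  qed
  have s0: "integral\<^sup>L lborel (s n) = 0" for n
    unfolding s_def using shift uint by (simp add: Bochner_Integration.integral_diff)
  \<comment> \<open>The mean value theorem bounds the quotient by \<open>C\<close>. Beyond radius
    \<open>R + norm e\<close> both \<open>x\<close> and its shift lie outside \<open>K\<close>, so
    the quotient is 0.\<close>
  have bound: "norm (s n x) \<le> C * indicator (cball 0 (R + norm e)) x" for n x
  proof -
    obtain z where z: "u (x + \<tau> n *\<^sub>R e) - u (x + 0 *\<^sub>R e) = (\<tau> n - 0) * dir_deriv e u (x + z *\<^sub>R e)"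
      using MVT2[of 0 "\<tau> n" "\<lambda>t. u (x + t *\<^sub>R e)" "\<lambda>t. dir_deriv e u (x + t *\<^sub>R e)"] \<tau> der by blast
    then have "s n x = dir_deriv e u (x + z *\<^sub>R e)"
      using \<tau>(1)[of n] by (simp add: s_def)
    then have 1: "norm (s n x) \<le> C"
      using C by simp
    have 2: "s n x = 0" if "norm x > R + norm e"
    proof -
      have "norm (\<tau> n *\<^sub>R e) \<le> norm e"
        using \<tau>[of n] by (simp add: mult_left_le_one_le)
      moreover have "norm x \<le> norm (x + \<tau> n *\<^sub>R e) + norm (\<tau> n *\<^sub>R e)"
        by (metis add_diff_cancel_right' norm_triangle_ineq4)
      ultimately have "norm (x + \<tau> n *\<^sub>R e) > R" "norm x > R"
        using that norm_ge_zero[of e] by linarith+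
      then show ?thesis
        unfolding s_def using R zero by (metis diff_self div_0 not_le)
    qed
    from 1 2 show ?thesis
      by (auto simp: indicator_def dist_norm not_le)
  qed
  have lim: "(\<lambda>n. s n x) \<longlonglongrightarrow> dir_deriv e u x" for x
  proof -
    have "filterlim \<tau> (at 0) sequentially"
      using LIMSEQ_inverse_real_of_nat \<tau>(1) unfolding \<tau>_def filterlim_at
      by (auto intro!: always_eventually)
    moreover have "((\<lambda>t. (u (x + t *\<^sub>R e) - u x) / t) \<longlongrightarrow> dir_deriv e u x) (at 0)"
      using der[of x 0] by (simp add: has_field_derivative_iff)
    ultimately show ?thesis
      unfolding s_def by (rule filterlim_compose[rotated])
  qed
  have "(\<lambda>n. integral\<^sup>L lborel (s n)) \<longlonglongrightarrow> integral\<^sup>L lborel (dir_deriv e u)"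
  proof (rule integral_dominated_convergence[where w = "\<lambda>x. C * indicator (cball 0 (R + norm e)) x"])
    show "integrable lborel (\<lambda>x. C * indicator (cball 0 (R + norm e)) x :: real)"
      using emeasure_lborel_cball_finite by (intro integrable_mult_right integrable_real_indicator) auto
    show "s n \<in> borel_measurable lborel" for n
      unfolding s_def by measurable
  qed (use bound lim in auto)
  then have "integral\<^sup>L lborel (dir_deriv e u) = 0"
    using s0 LIMSEQ_unique[OF _ tendsto_const[of 0]] by auto
  then show "integral\<^sup>L lebesgue (dir_deriv e u) = 0"
    by (simp add: integral_completion)
qed

section \<open>Bump functions and vanishing weak derivatives\<close>

text \<open>Squaring removes the kink of the positive part: at 0 the difference quotient is
  \<open>max 0 h\<close>, which tends to 0.\<close>

lemma DERIV_pos_part_square: "((\<lambda>t. (max 0 t)\<^sup>2) has_real_derivative 2 * max 0 t) (at t)"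
proof (cases t "0 :: real" rule: linorder_cases)
  case less
  have "((\<lambda>t. 0) has_real_derivative 2 * max 0 t) (at t)"
    using less by simp
  then show ?thesis
    by (rule has_field_derivative_transform_within_open[of _ _ _ "{..<0}"]) (use less in auto)
next
  case equal
  have "(\<lambda>h. (max 0 (t + h))\<^sup>2 / h) = (\<lambda>h. max 0 h :: real)"
    using equal by (auto simp: max_def power2_eq_square)
  moreover have "((\<lambda>h. max 0 h :: real) \<longlongrightarrow> max 0 0) (at 0)"
    by (intro tendsto_intros)
  ultimately show ?thesis
    using equal by (simp add: DERIV_def)
next
  case greater
  have "((\<lambda>t. t\<^sup>2) has_real_derivative 2 * max 0 t) (at t)"
    using greater by (auto intro!: derivative_eq_intros)
  then show ?thesis
    by (rule has_field_derivative_transform_within_open[of _ _ _ "{0<..}"]) (use greater in auto)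
qed

text \<open>The witness is the squared positive part of \<open>?w\<close>, a quadratic that is
  positive exactly inside the ball. The square makes it C1 across the sphere.\<close>

lemma C1_bump:
  fixes a :: "'a::euclidean_space"
  assumes "0 < r"
  shows "\<exists>b :: 'a \<Rightarrow> real. C1_on b UNIV \<and> (\<forall>x. 0 \<le> b x) \<and> (\<forall>x\<in>ball a r. 0 < b x) \<and>
    (\<forall>x. x \<notin> cball a r \<longrightarrow> b x = 0)"
proof (intro exI conjI ballI allI impI)
  let ?w = "\<lambda>x. r\<^sup>2 - (x - a) \<bullet> (x - a)"
  let ?b = "\<lambda>x. (max 0 (?w x))\<^sup>2"
  have w: "?w x = r\<^sup>2 - (dist a x)\<^sup>2" for x
    by (simp add: dist_norm norm_minus_commute dot_square_norm)
  show "C1_on ?b UNIV"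
  proof (rule C1_onI[where D = "\<lambda>x e. - (2 * ((x - a) \<bullet> e)) * (2 * max 0 (?w x))"])
    fix x :: 'a
    have "(?w has_derivative (\<lambda>e. - (2 * ((x - a) \<bullet> e)))) (at x)"
      by (auto intro!: derivative_eq_intros simp: inner_commute)
    then show "(?b has_derivative (\<lambda>e. - (2 * ((x - a) \<bullet> e)) * (2 * max 0 (?w x)))) (at x)"
      by (rule DERIV_compose_FDERIV[OF DERIV_pos_part_square])
  qed (intro continuous_intros)
  show "0 \<le> ?b x" for x
    by simp
  show "0 < ?b x" if "x \<in> ball a r" for x
  proof -
    have "(dist a x)\<^sup>2 < r\<^sup>2"
      using that by (intro power_strict_mono) auto
    then show ?thesis
      unfolding w by simp
  qed
  show "?b x = 0" if "x \<notin> cball a r" for x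
  proof -
    have "r\<^sup>2 \<le> (dist a x)\<^sup>2"
      using that assms by (intro power_mono) auto
    then show ?thesis
      unfolding w by simp
  qed
qed

text \<open>
  Integrating by parts against a bump function on a ball where \<open>dir_deriv e h\<close> keeps
  its sign gives a contradiction unless \<open>dir_deriv e h\<close> vanishes.
\<close>

lemma dir_deriv_eq_0_if_weakly:
  fixes h :: "'a::euclidean_space \<Rightarrow> real"
  assumes "open \<Omega>" and h: "C1_on h \<Omega>" and "a \<in> \<Omega>"
    and weak: "\<And>\<phi> K. \<lbrakk>C1_on \<phi> UNIV; compact K; K \<subseteq> \<Omega>; \<And>x. x \<notin> K \<Longrightarrow> \<phi> x = 0\<rbrakk> \<Longrightarrow>
      (LINT x|lebesgue. h x * dir_deriv e \<phi> x) = 0"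
  shows "dir_deriv e h a = 0"
proof (rule ccontr)
  \<comment> \<open>Multiplying by the value at \<open>a\<close> treats both signs at once:
    \<open>s * dir_deriv e h x\<close> is positive at \<open>a\<close>, hence on a closed ball
    around it.\<close>
  define s where "s = dir_deriv e h a"
  assume "dir_deriv e h a \<noteq> 0"
  then have s: "s * s > 0"
    by (metis s_def mult_neg_neg mult_pos_pos linorder_neqE)
  have dh: "continuous_on \<Omega> (dir_deriv e h)"
    by (rule C1_on_continuous_dir_deriv[OF h])
  have "open {x \<in> \<Omega>. s * dir_deriv e h x \<in> {0<..}}"
    using continuous_open_preimage[OF continuous_on_mult_left[OF dh, of s] \<open>open \<Omega>\<close>, of "{0<..}"]
    by (simp add: vimage_def Int_def)
  moreover have "a \<in> {x \<in> \<Omega>. s * dir_deriv e h x \<in> {0<..}}"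
    using s \<open>a \<in> \<Omega>\<close> by (simp add: s_def)
  ultimately obtain r where r: "r > 0" "cball a r \<subseteq> {x \<in> \<Omega>. s * dir_deriv e h x \<in> {0<..}}"
    by (meson open_contains_cball)
  define K where "K = cball a r"
  have K: "compact K" "K \<subseteq> \<Omega>" "\<And>x. x \<in> K \<Longrightarrow> 0 < s * dir_deriv e h x"
    using r(2) unfolding K_def by (simp, blast, force)
  obtain b :: "'a \<Rightarrow> real" where b: "C1_on b UNIV" "\<And>x. 0 \<le> b x" "\<And>x. x \<in> ball a r \<Longrightarrow> 0 < b x"
      "\<And>x. x \<notin> K \<Longrightarrow> b x = 0"
    using C1_bump[OF r(1), of a] unfolding K_def by meson
  have db0: "dir_deriv e b x = 0" if "x \<notin> K" for x
    by (rule dir_deriv_eq_0_off_compact[OF K(1) b(4) that])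
  have bS: "C1_on b S" for S
    using b(1) unfolding C1_on_def by (meson UNIV_I continuous_on_subset subset_UNIV)
  \<comment> \<open>\<open>h\<close> is controlled on \<open>\<Omega>\<close> only, but the product
    vanishes off \<open>K\<close> and is therefore C1 on the whole space.\<close>
  have hb: "C1_on (\<lambda>x. h x * b x) UNIV"
    by (rule C1_on_zero_extension[OF \<open>open \<Omega>\<close> K(1,2) C1_on_mult[OF h bS]]) (simp add: b(4))
  have int1: "integrable lebesgue (dir_deriv e (\<lambda>x. h x * b x))"
      "(LINT x|lebesgue. dir_deriv e (\<lambda>x. h x * b x) x) = 0"
    by (rule integral_dir_deriv_compact_support[OF hb K(1)], simp add: b(4))+
  have hK: "continuous_on K h" "continuous_on K (dir_deriv e h)"
    using continuous_on_subset[OF _ K(2)] C1_on_imp_continuous_on[OF h] dh by blast+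
  have int2: "integrable lebesgue (\<lambda>x. h x * dir_deriv e b x)"
    by (rule integrable_compact_support[OF _ K(1)])
       (auto intro!: continuous_intros hK C1_on_continuous_dir_deriv[OF bS] simp: db0)
  have eq: "b x * dir_deriv e h x = dir_deriv e (\<lambda>x. h x * b x) x - h x * dir_deriv e b x" for x
  proof (cases "x \<in> \<Omega>")
    case True
    then show ?thesis
      using dir_deriv_mult[OF C1_on_imp_differentiable[OF h] C1_on_imp_differentiable[OF bS[of UNIV]]]
      by simp
  next
    case False
    then have "x \<notin> K"
      using K(2) by blast
    then show ?thesis
      using dir_deriv_eq_0_off_compact[OF K(1), of "\<lambda>x. h x * b x" x e] b(4) db0 by simp
  qed
  have int3: "integrable lebesgue (\<lambda>x. b x * dir_deriv e h x)" "(LINT x|lebesgue. b x * dir_deriv e h x) = 0"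
    unfolding eq using int1 int2 weak[OF b(1) K(1,2) b(4)]
    by (simp_all add: Bochner_Integration.integral_diff)
  \<comment> \<open>\<open>F\<close> is nonnegative with integral 0, hence zero almost everywhere.
    Yet it is nonzero throughout the open ball, which is not negligible.\<close>
  define F where "F x = s * (b x * dir_deriv e h x)" for x
  have "integrable lebesgue F" "integral\<^sup>L lebesgue F = 0"
    unfolding F_def using int3 by simp_all
  moreover have "0 \<le> F x" for x
  proof (cases "x \<in> K")
    case True
    have "F x = b x * (s * dir_deriv e h x)"
      by (simp add: F_def)
    then show ?thesis
      using b(2)[of x] K(3)[OF True] by simp
  qed (simp add: F_def b(4))
  ultimately have "AE x in lebesgue. F x = 0"
    using integral_nonneg_eq_0_iff_AE[of lebesgue F] by simp
  then have neg: "negligible {x. F x \<noteq> 0}"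
    by (simp add: completion.AE_iff_null_sets negligible_iff_null_sets)
  have "F x \<noteq> 0" if "x \<in> ball a r" for x
    using b(3)[OF that] K(3)[of x] that by (auto simp: F_def K_def)
  then have "negligible (ball a r)"
    using negligible_subset[OF neg] by blast
  then show False
    using open_not_negligible[of "ball a r"] r(1) by simp
qed

lemma eq_const_if_partial_derivatives_0:
  fixes h :: "real ^ 'n \<Rightarrow> real"
  assumes "open \<Omega>" "connected \<Omega>" and h: "C1_on h \<Omega>"
    and zero: "\<And>i x. x \<in> \<Omega> \<Longrightarrow> dir_deriv (axis i 1) h x = 0"
    and "x \<in> \<Omega>" "y \<in> \<Omega>"
  shows "h x = h y"
proof (rule has_derivative_zero_unique_connected[OF assms(1,2) _ assms(5,6)])
  fix z assume z: "z \<in> \<Omega>"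
  obtain D where D: "(h has_derivative D) (at z)"
    using C1_onE[OF h] z by metis
  have "D (axis i 1) = 0" for i
    using zero[OF z] has_derivative_imp_dir_deriv(2)[OF D] by metis
  \<comment> \<open>The vectors \<open>axis i 1\<close> form the basis of \<open>real ^ 'n\<close>,
    so the linear map \<open>D\<close> vanishes on a spanning set.\<close>
  then have "D b = 0" if "b \<in> Basis" for b
    using that unfolding Basis_vec_def by force
  then have "D v = 0" for v
    using linear_eq_0_on_span[OF bounded_linear.linear[OF has_derivative_bounded_linear[OF D]], of Basis v]
    by simp
  then have "D = (\<lambda>_. 0)"
    by blast
  with D show "(h has_derivative (\<lambda>_. 0)) (at z)"
    by simp
qed

section \<open>Supports, null sets and integrals over \<open>\<Omega>\<close>\<close>

lemma supp_eq_0: "x \<notin> supp p \<Longrightarrow> p x = 0"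
  unfolding supp_def by blast

lemma closed_supp: "closed (supp p)"
  unfolding supp_def closed_def by auto

lemma assumption_AD:
  assumes "assumption_A p \<Omega>"
  shows "open \<Omega>" "supp p - \<Omega> \<in> null_sets lebesgue" "\<And>x. x \<in> \<Omega> \<Longrightarrow> 0 < p x" "C1_on p \<Omega>"
    and "\<Omega> \<subseteq> supp p"
proof -
  show pos: "0 < p x" if "x \<in> \<Omega>" for x
    using assms that by (simp add: assumption_A_def)
  show "\<Omega> \<subseteq> supp p"
    using supp_eq_0[of _ p] pos by (metis less_irrefl subsetI)
qed (use assms in \<open>auto simp: assumption_A_def\<close>)

text \<open>Neither function is assumed measurable. Completeness of \<open>lebesgue\<close>
  transfers measurability between functions that agree off a null set, and if both are
  non-measurable then both integrals have the default value 0.\<close>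

lemma integral_cong_off_null:
  fixes F G :: "'a::euclidean_space \<Rightarrow> real"
  assumes N: "N \<in> null_sets lebesgue" and eq: "\<And>x. x \<notin> N \<Longrightarrow> F x = G x"
  shows "integrable lebesgue F \<longleftrightarrow> integrable lebesgue G" "integral\<^sup>L lebesgue F = integral\<^sup>L lebesgue G"
proof -
  have ae: "AE x in lebesgue. F x = G x" "AE x in lebesgue. G x = F x"
    using AE_not_in[OF N] eq by (auto elim!: eventually_mono)
  have meas: "F \<in> borel_measurable lebesgue \<longleftrightarrow> G \<in> borel_measurable lebesgue"
    using borel_measurable_AE ae by blast
  show "integrable lebesgue F \<longleftrightarrow> integrable lebesgue G"
  proof (cases "F \<in> borel_measurable lebesgue")
    case True
    then show ?thesis
      using integrable_cong_AE ae meas by blast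
  next
    case False
    then show ?thesis
      using meas borel_measurable_integrable by blast
  qed
  show "integral\<^sup>L lebesgue F = integral\<^sup>L lebesgue G"
  proof (cases "F \<in> borel_measurable lebesgue")
    case True
    then show ?thesis
      using integral_cong_AE ae meas by blast
  next
    case False
    then have "\<not> integrable lebesgue F" "\<not> integrable lebesgue G"
      using meas borel_measurable_integrable by blast+
    then show ?thesis
      by (simp add: not_integrable_integral_eq)
  qed
qed

text \<open>The part of the support outside \<open>\<Omega>\<close> is null and
  \<open>\<Omega>\<close> lies in the support. Expectations thus become integrals over
  \<open>\<Omega>\<close>, where the product rule applies.\<close>

lemma set_integral_supp:
  fixes F :: "real ^ 'n \<Rightarrow> real"
  assumes "assumption_A p \<Omega>"
  shows "(LINT x:supp p|lebesgue. F x) = (LINT x:\<Omega>|lebesgue. F x)"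
  unfolding set_lebesgue_integral_def
  by (rule integral_cong_off_null(2)[OF assumption_AD(2)[OF assms]])
     (use assumption_AD(5)[OF assms] in \<open>auto simp: indicator_def\<close>)

lemma expect_inner:
  assumes "assumption_A q \<Omega>" "b \<in> Basis"
  shows "expect q u \<bullet> b = (LINT x:\<Omega>|lebesgue. (u x \<bullet> b) * q x)"
  using assms by (simp add: expect_def set_integral_supp)

lemma expect_real:
  fixes u :: "real ^ 'n \<Rightarrow> real"
  assumes "assumption_A q \<Omega>"
  shows "expect q u = (LINT x:\<Omega>|lebesgue. u x * q x)"
  using expect_inner[OF assms, of 1 u] by simp

lemma expect_eq_neg_iff:
  fixes u v :: "real ^ 'n \<Rightarrow> real ^ 'n"
  assumes "assumption_A q \<Omega>"
  shows "expect q u = - expect q v \<longleftrightarrow>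
    (\<forall>i. (LINT x:\<Omega>|lebesgue. u x $ i * q x) = - (LINT x:\<Omega>|lebesgue. v x $ i * q x))"
proof -
  have "expect q w $ i = (LINT x:\<Omega>|lebesgue. w x $ i * q x)" for w :: "real ^ 'n \<Rightarrow> real ^ 'n" and i
    using expect_inner[OF assms, of "axis i 1" w] by (simp add: inner_axis)
  then show ?thesis
    by (simp add: vec_eq_iff)
qed

text \<open>Off the closed support, \<open>p\<close> vanishes on an open set, so the derivative of
  the product is 0 whatever \<open>\<phi>\<close> does there. The rest of the complement of
  \<open>\<Omega>\<close> is null, so the whole-space integrals equal those over
  \<open>\<Omega>\<close>.\<close>

lemma stein_class1_set_integral:
  assumes A: "assumption_A p \<Omega>" and \<phi>: "\<phi> \<in> stein_class1 p \<Omega>"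
  shows "set_integrable lebesgue \<Omega> (dir_deriv (axis i 1) (\<lambda>y. p y * \<phi> y))"
    and "(LINT x:\<Omega>|lebesgue. dir_deriv (axis i 1) (\<lambda>y. p y * \<phi> y) x) = 0"
proof -
  let ?d = "dir_deriv (axis i 1) (\<lambda>y. p y * \<phi> y)"
  have "integrable lebesgue (\<lambda>x. grad (\<lambda>x. p x * \<phi> x) x \<bullet> axis i 1)"
    using \<phi> by (intro integrable_inner_left) (auto simp: stein_class1_def)
  then have int: "integrable lebesgue ?d"
    by (simp add: grad_def inner_axis)
  have zero: "(LINT x|lebesgue. ?d x) = 0"
    using \<phi> by (auto simp: stein_class1_def)
  have eq: "indicator \<Omega> x *\<^sub>R ?d x = ?d x" if "x \<notin> supp p - \<Omega>" for x
  proof (cases "x \<in> \<Omega>")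
    case False
    then have "x \<in> - supp p"
      using that by blast
    then have "?d x = 0"
      by (rule dir_deriv_eq_0[rotated]) (auto simp: supp_eq_0 closed_supp open_Compl)
    then show ?thesis
      by simp
  qed simp
  show "set_integrable lebesgue \<Omega> ?d" "(LINT x:\<Omega>|lebesgue. ?d x) = 0"
    unfolding set_integrable_def set_lebesgue_integral_def
    using integral_cong_off_null[OF assumption_AD(2)[OF A] eq] int zero by simp_all
qed

text \<open>
  Neither summand has to be integrable: if one of them is not, then neither is the other,
  and both integrals have the value 0.
\<close>

lemma set_integral_eq_neg:
  fixes u v w :: "'a \<Rightarrow> real"
  assumes "set_integrable M S w" "(LINT x:S|M. w x) = 0" and eq: "\<And>x. x \<in> S \<Longrightarrow> u x + v x = w x"
  shows "(LINT x:S|M. u x) = - (LINT x:S|M. v x)"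
proof -
  let ?I = "\<lambda>u x. indicator S x *\<^sub>R u x"
  have v: "?I v = (\<lambda>x. ?I w x - ?I u x)" and u: "?I u = (\<lambda>x. ?I w x - ?I v x)"
    using eq by (fastforce simp: indicator_def)+
  show ?thesis
  proof (cases "integrable M (?I u)")
    case True
    then show ?thesis
      using assms(1,2) unfolding set_integrable_def set_lebesgue_integral_def v
      by (simp add: Bochner_Integration.integral_diff)
  next
    case False
    then have "\<not> integrable M (?I v)"
      using assms(1) u Bochner_Integration.integrable_diff[of M "?I w" "?I v"]
      unfolding set_integrable_def by metis
    with False show ?thesis
      by (simp add: set_lebesgue_integral_def not_integrable_integral_eq)
  qed
qed

section \<open>Compactly supported test functions and proportionality of the densities\<close>

text \<open>The product of \<open>p\<close> and \<open>\<phi>\<close> vanishes off \<open>K\<close>,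
  so it is C1 on the whole space even where \<open>p\<close> is not. Its gradient is continuous with
  compact support, and its partial derivatives integrate to 0.\<close>

lemma stein_class1_compact_support:
  fixes \<phi> :: "real ^ 'n \<Rightarrow> real"
  assumes A: "assumption_A p \<Omega>" and \<phi>: "C1_on \<phi> \<Omega>"
    and K: "compact K" "K \<subseteq> \<Omega>" and zero: "\<And>x. x \<notin> K \<Longrightarrow> \<phi> x = 0"
  shows "\<phi> \<in> stein_class1 p \<Omega>"
proof -
  have c: "C1_on (\<lambda>x. p x * \<phi> x) UNIV"
    by (rule C1_on_zero_extension[OF assumption_AD(1)[OF A] K C1_on_mult[OF assumption_AD(4)[OF A] \<phi>]])
       (simp add: zero)
  have z: "p x * \<phi> x = 0" if "x \<notin> K" for x
    using zero[OF that] by simp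
  have "integrable lebesgue (grad (\<lambda>x. p x * \<phi> x))"
  proof (rule integrable_compact_support[OF _ K(1)])
    show "continuous_on K (grad (\<lambda>x. p x * \<phi> x))"
      unfolding grad_def
      by (intro continuous_on_vec_lambda continuous_on_subset[OF C1_on_continuous_dir_deriv[OF c]]) simp
    show "grad (\<lambda>x. p x * \<phi> x) x = 0" if "x \<notin> K" for x
      using dir_deriv_eq_0_off_compact[OF K(1) z that] by (simp add: grad_def vec_eq_iff)
  qed
  then show ?thesis
    using \<phi> integral_dir_deriv_compact_support[OF c K(1) z] by (simp add: stein_class1_def)
qed

text \<open>Supplies the test functions for the converse: compact support inside
  \<open>\<Omega>\<close> makes all integrability and boundary conditions of
  \<open>stein_dom\<close> hold automatically.\<close>

lemma stein_dom_compact_support: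
  fixes g :: "real ^ 'n \<Rightarrow> 'b::euclidean_space"
  assumes A: "assumption_A p \<Omega>" and f: "C1_on f \<Omega>" and g: "C1_on g \<Omega>"
    and K: "compact K" "K \<subseteq> \<Omega>" and zero: "\<And>x. x \<notin> K \<Longrightarrow> g x = 0"
  shows "g \<in> stein_dom p \<Omega> f"
proof -
  have "(\<lambda>x. (f x *\<^sub>R g x) \<bullet> b) \<in> stein_class1 p \<Omega>" for b
  proof (rule stein_class1_compact_support[OF A _ K])
    show "C1_on (\<lambda>x. (f x *\<^sub>R g x) \<bullet> b) \<Omega>"
      by (rule C1_on_linear[OF bounded_linear_inner_left C1_on_scaleR[OF f g]])
  qed (simp add: zero)
  then have "(\<lambda>x. f x *\<^sub>R g x) \<in> stein_class p \<Omega>"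
    by (simp add: stein_class_def)
  moreover have "(\<lambda>x. f x *\<^sub>R dir_deriv e g x) \<in> L1 p" for e
  proof -
    have c: "continuous_on K u" if "continuous_on \<Omega> u" for u :: "real ^ 'n \<Rightarrow> 'c::topological_space"
      using continuous_on_subset[OF that K(2)] .
    have "integrable lebesgue (\<lambda>x. p x *\<^sub>R f x *\<^sub>R dir_deriv e g x)"
      by (rule integrable_compact_support[OF _ K(1)])
         (auto intro!: continuous_intros c C1_on_imp_continuous_on[OF f]
           C1_on_imp_continuous_on[OF assumption_AD(4)[OF A]] C1_on_continuous_dir_deriv[OF g] simp: dir_deriv_eq_0_off_compact[OF K(1) zero])
    then show ?thesis
      unfolding L1_def set_integrable_def mem_Collect_eq
      by (rule integrable_mult_indicator[rotated]) (simp add: closed_supp borel_closed)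
  qed
  ultimately show ?thesis
    using g by (simp add: stein_dom_def)
qed

text \<open>The hypothesis \<open>stein\<close> is the coordinate form to which the vector and the
  scalar identity both reduce. The sign of the constant is recorded for the later comparison of
  total masses in \<open>ennreal\<close>.\<close>

lemma density_proportional:
  fixes p q f :: "real ^ 'n \<Rightarrow> real"
  assumes A: "assumption_A p \<Omega>" and B: "assumption_A q \<Omega>" and "connected \<Omega>"
    and f: "C1_on f \<Omega>" "\<And>x. x \<in> \<Omega> \<Longrightarrow> 0 < f x"
    and stein: "\<And>g K i. \<lbrakk>C1_on g \<Omega>; compact K; K \<subseteq> \<Omega>; \<And>x. x \<notin> K \<Longrightarrow> g x = 0\<rbrakk> \<Longrightarrow>
      (LINT x:\<Omega>|lebesgue. f x * dir_deriv (axis i 1) (\<lambda>y. p y * g y) x / p x * q x) =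
      - (LINT x:\<Omega>|lebesgue. g x * dir_deriv (axis i 1) f x * q x)"
  shows "\<exists>c\<ge>0. \<forall>x\<in>\<Omega>. q x = c * p x"
proof -
  define h where "h x = q x / p x" for x
  note p = assumption_AD[OF A] and q = assumption_AD[OF B]
  have h: "C1_on h \<Omega>"
    unfolding h_def using p(3) by (intro C1_on_divide p(4) q(4)) force
  have "dir_deriv (axis i 1) h x = 0" if "x \<in> \<Omega>" for i x
  proof (rule dir_deriv_eq_0_if_weakly[OF p(1) h that])
    fix \<phi> :: "real ^ 'n \<Rightarrow> real" and K
    assume \<phi>: "C1_on \<phi> UNIV" and K: "compact K" "K \<subseteq> \<Omega>" and zero: "\<And>x. x \<notin> K \<Longrightarrow> \<phi> x = 0"
    define e where "e = (axis i 1 :: real ^ 'n)"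
    define g where "g x = \<phi> x / (p x * f x)" for x
    have \<phi>S: "C1_on \<phi> \<Omega>"
      using \<phi> unfolding C1_on_def by (meson UNIV_I continuous_on_subset subset_UNIV)
    have g: "C1_on g \<Omega>"
      unfolding g_def using p(3) f(2) by (intro C1_on_divide \<phi>S C1_on_mult p(4) f(1)) force
    have g0: "g x = 0" if "x \<notin> K" for x
      using zero[OF that] by (simp add: g_def)
    have pg: "C1_on (\<lambda>x. p x * g x) \<Omega>"
      by (rule C1_on_mult[OF p(4) g])
    have pg0: "dir_deriv e (\<lambda>y. p y * g y) x = 0" if "x \<notin> K" for x
      by (rule dir_deriv_eq_0_off_compact[OF K(1) _ that]) (simp add: g0)
    \<comment> \<open>The choice of \<open>g\<close> makes \<open>p g f\<close> equal to
      \<open>\<phi>\<close> on \<open>\<Omega>\<close>. The product rule splits its derivative, and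
      the factor \<open>h = q / p\<close> turns the two pieces into the two Stein
      integrands.\<close>
    have eq: "f x * dir_deriv e (\<lambda>y. p y * g y) x / p x * q x + g x * dir_deriv e f x * q x
        = h x * dir_deriv e \<phi> x" if x: "x \<in> \<Omega>" for x
    proof -
      \<comment> \<open>\<open>p\<close> and \<open>f\<close> are known to cancel only on
        \<open>\<Omega>\<close>; as \<open>\<Omega>\<close> is open, that is enough for the
        derivatives to agree.\<close>
      have "dir_deriv e \<phi> x = dir_deriv e (\<lambda>y. (p y * g y) * f y) x"
      proof -
        obtain D where D: "(\<phi> has_derivative D) (at x)"
          using C1_onE[OF \<phi>S] x by metis
        have "((\<lambda>y. (p y * g y) * f y) has_derivative D) (at x)"
          by (rule has_derivative_transform_within_open[OF D p(1) x])
             (use p(3) f(2) in \<open>force simp: g_def\<close>)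
        then show ?thesis
          using has_derivative_imp_dir_deriv(2) D by metis
      qed
      also have "\<dots> = (p x * g x) * dir_deriv e f x + dir_deriv e (\<lambda>y. p y * g y) x * f x"
        by (rule dir_deriv_mult[OF C1_on_imp_differentiable[OF pg x] C1_on_imp_differentiable[OF f(1) x]])
      finally show ?thesis
        using p(3)[OF x] by (simp add: h_def field_simps)
    qed
    have cK: "continuous_on K u" if "C1_on u \<Omega>" for u :: "real ^ 'n \<Rightarrow> real"
      using continuous_on_subset[OF C1_on_imp_continuous_on[OF that] K(2)] .
    have dK: "continuous_on K (dir_deriv e u)" if "C1_on u \<Omega>" for u :: "real ^ 'n \<Rightarrow> real"
      using continuous_on_subset[OF C1_on_continuous_dir_deriv[OF that] K(2)] .
    have pK: "p x \<noteq> 0" if "x \<in> K" for x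
      using p(3) K(2) that by force
    \<comment> \<open>For functions vanishing off \<open>K\<close> the integral over
      \<open>\<Omega>\<close> is the whole-space integral. This connects the Stein hypothesis with
      the weak derivative condition.\<close>
    have setI: "set_integrable lebesgue \<Omega> u" "(LINT x:\<Omega>|lebesgue. u x) = (LINT x|lebesgue. u x)"
      if "continuous_on K u" and "\<And>x. x \<notin> K \<Longrightarrow> u x = 0" for u :: "real ^ 'n \<Rightarrow> real"
    proof -
      have "(\<lambda>x. indicator \<Omega> x *\<^sub>R u x) = u"
        using that(2) K(2) by (auto simp: indicator_def fun_eq_iff)
      then show "set_integrable lebesgue \<Omega> u" "(LINT x:\<Omega>|lebesgue. u x) = (LINT x|lebesgue. u x)"
        using integrable_compact_support(2)[OF that(1) K(1) that(2)]
        by (simp_all add: set_integrable_def set_lebesgue_integral_def)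
    qed
    \<comment> \<open>Adding the two integrals requires each to exist; both integrands are
      continuous on the compact \<open>K\<close> and vanish off it.\<close>
    have i1: "set_integrable lebesgue \<Omega> (\<lambda>x. f x * dir_deriv e (\<lambda>y. p y * g y) x / p x * q x)"
      by (rule setI(1)) (auto intro!: continuous_intros cK[OF f(1)] dK[OF pg] cK[OF p(4)] cK[OF q(4)] simp: pK pg0)
    have i2: "set_integrable lebesgue \<Omega> (\<lambda>x. g x * dir_deriv e f x * q x)"
      by (rule setI(1)) (auto intro!: continuous_intros cK[OF g] dK[OF f(1)] cK[OF q(4)] simp: g0)
    have "(LINT x|lebesgue. h x * dir_deriv e \<phi> x) = (LINT x:\<Omega>|lebesgue. h x * dir_deriv e \<phi> x)"
      by (rule setI(2)[symmetric])
         (auto intro!: continuous_intros cK[OF h] dK[OF \<phi>S] simp: dir_deriv_eq_0_off_compact[OF K(1) zero])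
    also have "\<dots> = (LINT x:\<Omega>|lebesgue. f x * dir_deriv e (\<lambda>y. p y * g y) x / p x * q x
        + g x * dir_deriv e f x * q x)"
      by (intro set_lebesgue_integral_cong) (use p(1) eq in \<open>auto intro: borel_open\<close>)
    also have "\<dots> = 0"
      using set_integral_add(2)[OF i1 i2] stein[OF g K g0, of i] by (simp add: e_def)
    finally show "(LINT x|lebesgue. h x * dir_deriv (axis i 1) \<phi> x) = 0"
      by (simp add: e_def)
  qed
  then have const: "h x = h y" if "x \<in> \<Omega>" "y \<in> \<Omega>" for x y
    using eq_const_if_partial_derivatives_0[OF p(1) \<open>connected \<Omega>\<close> h] that by blast
  show ?thesis
  proof (cases "\<Omega> = {}")
    case True
    then show ?thesis
      by auto
  next
    case False
    then obtain a where a: "a \<in> \<Omega>" by blast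
    show ?thesis
    proof (intro exI[of _ "h a"] conjI ballI)
      show "0 \<le> h a"
        using p(3)[OF a] q(3)[OF a] by (simp add: h_def)
      show "q x = h a * p x" if "x \<in> \<Omega>" for x
        using const[OF that a] p(3)[OF that] by (simp add: h_def field_simps)
    qed
  qed
qed

section \<open>From densities to laws\<close>

text \<open>Outside both supports both sides are 0, and the parts of the supports outside
  \<open>\<Omega>\<close> are null.\<close>

lemma AE_lborel_proportional:
  assumes A: "assumption_A p \<Omega>" and B: "assumption_A q \<Omega>"
    and c: "\<And>x. x \<in> \<Omega> \<Longrightarrow> q x = c * p x"
  shows "AE x in lborel. q x = c * p x"
proof -
  have "AE x in lebesgue. q x = c * p x"
    using AE_not_in[OF assumption_AD(2)[OF A]] AE_not_in[OF assumption_AD(2)[OF B]]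
  proof eventually_elim
    case (elim x)
    show ?case
    proof (cases "x \<in> \<Omega>")
      case False
      then show ?thesis
        using elim supp_eq_0[of x p] supp_eq_0[of x q] by simp
    qed (rule c)
  qed
  then show ?thesis
    by (simp add: AE_completion_iff)
qed

lemma distributed_nn_integral_1:
  assumes "prob_space M" "distributed M lborel X f"
  shows "(\<integral>\<^sup>+ x. f x \<partial>lborel) = 1"
proof -
  interpret prob_space M by fact
  have "prob_space (density lborel f)"
    using prob_space_distr distributed_measurable[OF assms(2)] distributed_distr_eq_density[OF assms(2)]
    by metis
  then have "emeasure (density lborel f) (space lborel) = 1"
    using prob_space.emeasure_space_1 by fastforce
  then show ?thesis
    using distributed_borel_measurable[OF assms(2)] by (simp add: emeasure_density)
qed

text \<open>Densities with respect to a sigma-finite measure are unique up to null sets;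
  nonnegativity allows \<open>ennreal\<close> to be dropped.\<close>

lemma same_law_iff_AE:
  fixes p q :: "real ^ 'n \<Rightarrow> real"
  assumes "distributed M lborel X (\<lambda>x. ennreal (p x))" "distributed N lborel Y (\<lambda>x. ennreal (q x))"
    and "\<And>x. 0 \<le> p x" "\<And>x. 0 \<le> q x"
  shows "distr N borel Y = distr M borel X \<longleftrightarrow> (AE x in lborel. q x = p x)"
proof -
  have "distr M borel X = density lborel (\<lambda>x. ennreal (p x))"
    "distr N borel Y = density lborel (\<lambda>x. ennreal (q x))"
    using distributed_distr_eq_density[OF assms(1)] distributed_distr_eq_density[OF assms(2)]
    by (simp_all cong: distr_cong)
  moreover have "density lborel (\<lambda>x. ennreal (q x)) = density lborel (\<lambda>x. ennreal (p x)) \<longleftrightarrow>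
      (AE x in lborel. ennreal (q x) = ennreal (p x))"
    using distributed_borel_measurable[OF assms(1)] distributed_borel_measurable[OF assms(2)]
    by (intro sigma_finite_measure.density_unique_iff sigma_finite_lborel) auto
  ultimately show ?thesis
    using assms(3,4) by simp
qed

text \<open>Both densities are continuous on \<open>\<Omega>\<close>, so the points of
  \<open>\<Omega>\<close> where they differ form an open set; being negligible, it is empty.\<close>

lemma same_law_imp_eq_on:
  assumes A: "assumption_A p \<Omega>" and B: "assumption_A q \<Omega>"
    and ae: "AE x in lborel. q x = p x" and "x \<in> \<Omega>"
  shows "q x = p x"
proof -
  have "negligible {x. q x \<noteq> p x}"
    using AE_completion[OF ae] by (simp add: completion.AE_iff_null_sets negligible_iff_null_sets)
  moreover have "open (\<Omega> \<inter> (\<lambda>x. q x - p x) -` (- {0}))"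
    by (intro continuous_open_preimage continuous_on_diff C1_on_imp_continuous_on assumption_AD(1)[OF A]
        assumption_AD(4)[OF A] assumption_AD(4)[OF B]) auto
  moreover have "\<Omega> \<inter> (\<lambda>x. q x - p x) -` (- {0}) \<subseteq> {x. q x \<noteq> p x}"
    by auto
  ultimately have "\<Omega> \<inter> (\<lambda>x. q x - p x) -` (- {0}) = {}"
    using negligible_subset open_not_negligible by blast
  then show ?thesis
    using \<open>x \<in> \<Omega>\<close> by auto
qed

section \<open>The Stein identities when the densities agree\<close>

lemma T_grad_component: "T_grad p g x $ i = dir_deriv (axis i 1) (\<lambda>y. p y * g y) x / p x"
  by (simp add: T_grad_def grad_def divide_inverse_commute)

lemma T_div_sum: "T_div p g x = (\<Sum>i\<in>UNIV. dir_deriv (axis i 1) (\<lambda>y. p y * g y $ i) x) / p x"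
  by (simp add: T_div_def divergence_def)

lemma inner_grad: "v \<bullet> grad f x = (\<Sum>i\<in>UNIV. v $ i * dir_deriv (axis i 1) f x)"
  by (simp add: inner_vec_def grad_def)

text \<open>Grouping the product as \<open>f\<close> times \<open>p g\<close> keeps the derivative
  of \<open>p g\<close>, the numerator of the Stein operators, in one piece.\<close>

lemma dir_deriv_weighted:
  fixes p f g :: "real ^ 'n \<Rightarrow> real"
  assumes "C1_on p \<Omega>" "C1_on f \<Omega>" "C1_on g \<Omega>" "x \<in> \<Omega>"
  shows "dir_deriv e (\<lambda>y. p y * (f y * g y)) x =
    f x * dir_deriv e (\<lambda>y. p y * g y) x + g x * dir_deriv e f x * p x"
proof -
  have "(\<lambda>y. p y * (f y * g y)) = (\<lambda>y. f y * (p y * g y))"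
    by (simp add: fun_eq_iff)
  then show ?thesis
    using dir_deriv_mult[OF C1_on_imp_differentiable[OF assms(2,4)]
        C1_on_imp_differentiable[OF C1_on_mult[OF assms(1,3)] assms(4)], of e]
    by simp
qed

lemma stein_identity_vector:
  fixes p q f :: "real ^ 'n \<Rightarrow> real" and g :: "real ^ 'n \<Rightarrow> real ^ 'n"
  assumes A: "assumption_A p \<Omega>" and B: "assumption_A q \<Omega>" and qp: "\<And>x. x \<in> \<Omega> \<Longrightarrow> q x = p x"
    and f: "C1_on f \<Omega>" and g: "g \<in> stein_dom p \<Omega> f"
  shows "expect q (\<lambda>x. T_div p g x * f x) = - expect q (\<lambda>x. g x \<bullet> grad f x)"
proof -
  note p = assumption_AD[OF A]
  let ?w = "\<lambda>i x. dir_deriv (axis i 1) (\<lambda>y. p y * (f y * g y $ i)) x"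
  have "(\<lambda>x. f x * g x $ i) \<in> stein_class1 p \<Omega>" for i
    using g axis_in_Basis_iff[of i "1::real"] unfolding stein_dom_def stein_class_def
    by (auto simp: inner_axis dest!: bspec[of Basis _ "axis i 1"])
  then have w: "set_integrable lebesgue \<Omega> (?w i)" "(LINT x:\<Omega>|lebesgue. ?w i x) = 0" for i
    by (rule stein_class1_set_integral[OF A])+
  have gi: "C1_on (\<lambda>x. g x $ i) \<Omega>" for i
    using g by (intro C1_on_linear[OF bounded_linear_vec_nth]) (simp add: stein_dom_def)
  \<comment> \<open>The two integrals need not exist separately. Only the sum of the integrands, the
    divergence of \<open>p f g\<close>, is known to be integrable with integral 0.\<close>
  have "(LINT x:\<Omega>|lebesgue. T_div p g x * f x * q x) = - (LINT x:\<Omega>|lebesgue. (g x \<bullet> grad f x) * q x)"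
  proof (rule set_integral_eq_neg[where w = "\<lambda>x. \<Sum>i\<in>UNIV. ?w i x"])
    show "set_integrable lebesgue \<Omega> (\<lambda>x. \<Sum>i\<in>UNIV. ?w i x)"
      using w(1) unfolding set_integrable_def scaleR_sum_right
      by (intro Bochner_Integration.integrable_sum)
    show "(LINT x:\<Omega>|lebesgue. (\<Sum>i\<in>UNIV. ?w i x)) = 0"
      using w unfolding set_integrable_def set_lebesgue_integral_def scaleR_sum_right
      by (subst Bochner_Integration.integral_sum) auto
    fix x assume x: "x \<in> \<Omega>"
    show "T_div p g x * f x * q x + (g x \<bullet> grad f x) * q x = (\<Sum>i\<in>UNIV. ?w i x)"
      using p(3)[OF x]
      by (simp add: qp[OF x] T_div_sum inner_grad dir_deriv_weighted[OF p(4) f gi x] sum.distrib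
          sum_distrib_left sum_distrib_right sum_divide_distrib mult.commute)
  qed
  then show ?thesis
    by (simp add: expect_real[OF B])
qed

text \<open>The same cancellation without a sum: for each \<open>i\<close> the components of the two
  integrands add up to the partial derivative of \<open>p f g\<close> in direction
  \<open>axis i 1\<close>.\<close>

lemma stein_identity_scalar:
  fixes p q f g :: "real ^ 'n \<Rightarrow> real"
  assumes A: "assumption_A p \<Omega>" and B: "assumption_A q \<Omega>" and qp: "\<And>x. x \<in> \<Omega> \<Longrightarrow> q x = p x"
    and f: "C1_on f \<Omega>" and g: "g \<in> stein_dom p \<Omega> f"
  shows "expect q (\<lambda>x. f x *\<^sub>R T_grad p g x) = - expect q (\<lambda>x. g x *\<^sub>R grad f x)"
  unfolding expect_eq_neg_iff[OF B]
proof
  fix i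
  note p = assumption_AD[OF A]
  have fg: "(\<lambda>x. f x * g x) \<in> stein_class1 p \<Omega>" and g1: "C1_on g \<Omega>"
    using g by (simp_all add: stein_dom_def stein_class_def)
  show "(LINT x:\<Omega>|lebesgue. (f x *\<^sub>R T_grad p g x) $ i * q x) =
      - (LINT x:\<Omega>|lebesgue. (g x *\<^sub>R grad f x) $ i * q x)"
  proof (rule set_integral_eq_neg[OF stein_class1_set_integral[OF A fg]])
    fix x assume x: "x \<in> \<Omega>"
    show "(f x *\<^sub>R T_grad p g x) $ i * q x + (g x *\<^sub>R grad f x) $ i * q x =
        dir_deriv (axis i 1) (\<lambda>y. p y * (f y * g y)) x"
      using p(3)[OF x]
      by (simp add: qp[OF x] T_grad_component grad_def dir_deriv_weighted[OF p(4) f g1 x])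
  qed
qed

section \<open>Both characterisations of the law\<close>

theorem theorem3p5:
  fixes M :: "'a measure" and N :: "'b measure"
    and X :: "'a \<Rightarrow> real ^ 'n" and Y :: "'b \<Rightarrow> real ^ 'n"
    and p q f :: "real ^ 'n \<Rightarrow> real"
    and \<Omega>p \<Omega>q :: "(real ^ 'n) set"
  assumes "prob_space M" and "prob_space N"
    and "\<And>x. 0 \<le> p x" and "\<And>x. 0 \<le> q x"
    and "distributed M lborel X (\<lambda>x. ennreal (p x))"
    and "distributed N lborel Y (\<lambda>x. ennreal (q x))"
    and "assumption_A p \<Omega>p" and "assumption_A q \<Omega>q"
    and "\<Omega>p = \<Omega>q" and "connected \<Omega>p"
    and "f \<in> stein_class1 p \<Omega>p"
    and "\<forall>x\<in>\<Omega>p. 0 < f x"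
  shows "(distr N borel Y = distr M borel X \<longleftrightarrow>
      (\<forall>g :: real ^ 'n \<Rightarrow> real ^ 'n. g \<in> stein_dom p \<Omega>p f \<longrightarrow>
        expect q (\<lambda>x. T_div p g x * f x) = - expect q (\<lambda>x. g x \<bullet> grad f x))) \<and>
    (distr N borel Y = distr M borel X \<longleftrightarrow>
      (\<forall>g :: real ^ 'n \<Rightarrow> real. g \<in> stein_dom p \<Omega>p f \<longrightarrow>
        expect q (\<lambda>x. f x *\<^sub>R T_grad p g x) = - expect q (\<lambda>x. g x *\<^sub>R grad f x)))"
proof -
  note A = \<open>assumption_A p \<Omega>p\<close>
  have B: "assumption_A q \<Omega>p"
    using \<open>assumption_A q \<Omega>q\<close> \<open>\<Omega>p = \<Omega>q\<close> by simp
  have f: "C1_on f \<Omega>p"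
    using \<open>f \<in> stein_class1 p \<Omega>p\<close> by (simp add: stein_class1_def)
  have f_pos: "\<And>x. x \<in> \<Omega>p \<Longrightarrow> 0 < f x"
    using \<open>\<forall>x\<in>\<Omega>p. 0 < f x\<close> by blast
  let ?law = "distr N borel Y = distr M borel X"
  have law: "?law \<longleftrightarrow> (AE x in lborel. q x = p x)"
    by (rule same_law_iff_AE) fact+
  have eq_on: "\<And>x. x \<in> \<Omega>p \<Longrightarrow> q x = p x" if ?law
    using same_law_imp_eq_on[OF A B] that law by blast
  have converse: ?law
    if stein: "\<And>g K i. \<lbrakk>C1_on g \<Omega>p; compact K; K \<subseteq> \<Omega>p; \<And>x. x \<notin> K \<Longrightarrow> g x = 0\<rbrakk> \<Longrightarrow>
      (LINT x:\<Omega>p|lebesgue. f x * dir_deriv (axis i 1) (\<lambda>y. p y * g y) x / p x * q x) =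
      - (LINT x:\<Omega>p|lebesgue. g x * dir_deriv (axis i 1) f x * q x)"
  proof -
    have "\<exists>c\<ge>0. \<forall>x\<in>\<Omega>p. q x = c * p x"
      by (rule density_proportional[OF A B \<open>connected \<Omega>p\<close> f f_pos stein])
    then obtain c where c: "0 \<le> c" "\<And>x. x \<in> \<Omega>p \<Longrightarrow> q x = c * p x"
      by blast
    have ae: "AE x in lborel. q x = c * p x"
      by (rule AE_lborel_proportional[OF A B c(2)])
    note one = distributed_nn_integral_1[OF \<open>prob_space M\<close> \<open>distributed M lborel X p\<close>]
      distributed_nn_integral_1[OF \<open>prob_space N\<close> \<open>distributed N lborel Y q\<close>]
    \<comment> \<open>Both densities have total mass 1, so integrating the almost everywhere
      proportionality forces the constant to be 1.\<close>
    have "1 = (\<integral>\<^sup>+ x. ennreal c * ennreal (p x) \<partial>lborel)"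
      unfolding one(2)[symmetric] using ae c(1)
      by (intro nn_integral_cong_AE) (auto elim!: eventually_mono simp: ennreal_mult')
    also have "\<dots> = ennreal c"
      using distributed_borel_measurable[OF \<open>distributed M lborel X p\<close>] one(1)
      by (subst nn_integral_cmult) auto
    finally have "c = 1"
      using c(1) by simp
    then show ?law
      using law ae by simp
  qed
  have vector: ?law
    if id: "\<forall>g :: real ^ 'n \<Rightarrow> real ^ 'n. g \<in> stein_dom p \<Omega>p f \<longrightarrow>
        expect q (\<lambda>x. T_div p g x * f x) = - expect q (\<lambda>x. g x \<bullet> grad f x)"
  proof (rule converse)
    fix g :: "real ^ 'n \<Rightarrow> real" and K and i :: 'n
    assume g: "C1_on g \<Omega>p" and K: "compact K" "K \<subseteq> \<Omega>p" "\<And>x. x \<notin> K \<Longrightarrow> g x = 0"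
    \<comment> \<open>Placing \<open>g\<close> in the single coordinate \<open>i\<close> isolates
      the partial derivative in that direction: in every other coordinate the function
      differentiated in the divergence is identically 0.\<close>
    define G where "G x = g x *\<^sub>R axis i (1::real)" for x
    have G: "C1_on G \<Omega>p"
      unfolding G_def using C1_on_linear[OF bounded_linear_scaleR_left g] .
    have "G \<in> stein_dom p \<Omega>p f"
      by (rule stein_dom_compact_support[OF A f G K(1,2)]) (simp add: G_def K(3))
    then have "(LINT x:\<Omega>p|lebesgue. T_div p G x * f x * q x) =
        - (LINT x:\<Omega>p|lebesgue. (G x \<bullet> grad f x) * q x)"
      using id by (simp add: expect_real[OF B])
    moreover have "T_div p G x * f x * q x =
        f x * dir_deriv (axis i 1) (\<lambda>y. p y * g y) x / p x * q x" for x
    proof -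
      have "dir_deriv (axis j 1) (\<lambda>y. p y * G y $ j) x =
          (if j = i then dir_deriv (axis i 1) (\<lambda>y. p y * g y) x else 0)" for j
        using dir_deriv_eq_0[of UNIV x "\<lambda>y. 0 :: real"] by (simp add: G_def axis_def)
      then show ?thesis
        by (simp add: T_div_sum)
    qed
    moreover have "G x \<bullet> grad f x = g x * dir_deriv (axis i 1) f x" for x
      by (simp add: G_def grad_def inner_axis')
    ultimately show "(LINT x:\<Omega>p|lebesgue. f x * dir_deriv (axis i 1) (\<lambda>y. p y * g y) x / p x * q x) =
        - (LINT x:\<Omega>p|lebesgue. g x * dir_deriv (axis i 1) f x * q x)"
      by simp
  qed
  have scalar: ?law
    if id: "\<forall>g :: real ^ 'n \<Rightarrow> real. g \<in> stein_dom p \<Omega>p f \<longrightarrow>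
        expect q (\<lambda>x. f x *\<^sub>R T_grad p g x) = - expect q (\<lambda>x. g x *\<^sub>R grad f x)"
  proof (rule converse)
    fix g :: "real ^ 'n \<Rightarrow> real" and K and i :: 'n
    assume g: "C1_on g \<Omega>p" and K: "compact K" "K \<subseteq> \<Omega>p" "\<And>x. x \<notin> K \<Longrightarrow> g x = 0"
    have "g \<in> stein_dom p \<Omega>p f"
      by (rule stein_dom_compact_support[OF A f g K])
    then show "(LINT x:\<Omega>p|lebesgue. f x * dir_deriv (axis i 1) (\<lambda>y. p y * g y) x / p x * q x) =
        - (LINT x:\<Omega>p|lebesgue. g x * dir_deriv (axis i 1) f x * q x)"
      using id by (simp add: expect_eq_neg_iff[OF B] T_grad_component grad_def)
  qed
  show ?thesis
    using stein_identity_vector[OF A B eq_on f] stein_identity_scalar[OF A B eq_on f] vector scalar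
    by blast
qed

end
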